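(* Let $m>1$ be an integer and let $C$ be a constant with $C>\frac{3}{\pi}\left(1-\frac{1}{m}\right)$. Then there exists $p_0$ (depending on $m$ and $C$) such that for every prime $p>p_0$ with $p\equiv 1\pmod m$ and every interval $(a,b)\subset(0,p)$ with real endpoints, the number $N$ of integers $k\in(a,b)$ that are $m$th power residues modulo $p$ satisfies \[\left|N-\frac{b-a}{m}\right|\le C\sqrt{p}\,\log p.\]
   Context: An integer $k$ not divisible by $p$ is an $m$th power residue modulo $p$ if $k\equiv x^m\pmod p$ for some integer $x$. Here $\log$ denotes the natural logarithm. *)

theory Defs
  imports Complex_Main "HOL-Number_Theory.Number_Theory"
begin

definition power_residue :: "nat \<Rightarrow> nat \<Rightarrow> int \<Rightarrow> bool" where
  "power_residue m p k \<longleftrightarrow> \<not> int p dvd k \<and> (\<exists>x::int. [k = x ^ m] (mod int p))"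

end

theory Submission
  imports Defs "HOL-Library.Real_Mod"
begin

text \<open>
  Write $e(k) = \exp(2\pi i k/p)$ and $G_t = \sum_{x \bmod p} e(t x^m)$. Every $m$th power residue has
  exactly $m$ roots, so detecting $x^m \equiv k$ with additive characters gives
  $m N = M + \frac1p \sum_{t=1}^{p-1} G_t \overline{E_t}$, where $M$ counts the integers in the interval
  and $E_t$ is a geometric sum with $|E_t| \le 1/\sin(\pi t/p)$.

  No multiplicative characters are needed to bound $G_t$: Parseval gives
  $\sum_{t \ne 0} |G_t|^2 = p(p-1)(m-1)$, and $G_t$ is constant on the $(p-1)/m$ residues
  $t s^m$, so $|G_t|^2 \le m(m-1)p$. This loses a factor $\sqrt{m/(m-1)}$ against the bound from Gauss sums, but
  $\sum_t 1/\sin(\pi t/p) \le \frac{2p}{\pi}(1 + \log p)$ leaves room for it, because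
  $\frac2\pi\sqrt{1-1/m} \le \frac3\pi(1-1/m)$ for $m \ge 2$.
\<close>

section \<open>Additive characters modulo \<open>p\<close>\<close>

definition addchar :: "nat \<Rightarrow> int \<Rightarrow> complex" where
  "addchar p k = cis (2 * pi * of_int k / of_nat p)"

lemma addchar_add: "addchar p (k + l) = addchar p k * addchar p l"
  by (simp add: addchar_def cis_mult ring_distribs add_divide_distrib)

lemma addchar_uminus: "addchar p (- k) = cnj (addchar p k)"
  by (simp add: addchar_def cis_cnj)

lemma addchar_0 [simp]: "addchar p 0 = 1"
  by (simp add: addchar_def)

lemma norm_addchar [simp]: "norm (addchar p k) = 1"
  by (simp add: addchar_def)

lemma addchar_diff: "addchar p (k - l) = addchar p k * cnj (addchar p l)"
  using addchar_add[of p k "- l"] by (simp add: addchar_uminus)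

lemma addchar_power: "addchar p k ^ n = addchar p (int n * k)"
  by (simp add: addchar_def DeMoivre mult_ac)

lemma addchar_eq_1_iff:
  assumes "p > 0"
  shows "addchar p k = 1 \<longleftrightarrow> int p dvd k"
proof -
  have "addchar p k = 1 \<longleftrightarrow> (\<exists>n::int. real_of_int k = of_int (int p * n))"
    using assms by (auto simp: addchar_def cis_eq_1_iff field_simps)
  thus ?thesis
    unfolding of_int_eq_iff by (auto simp: dvd_def)
qed

lemma addchar_cong:
  assumes "p > 0" "[k = l] (mod int p)"
  shows "addchar p k = addchar p l"
proof -
  have "addchar p (k - l) = 1"
    using assms by (simp add: addchar_eq_1_iff cong_iff_dvd_diff)
  thus ?thesis
    using addchar_add[of p "k - l" l] by simp
qed

lemma sum_addchar:
  assumes "p > 0"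
  shows "(\<Sum>t<p. addchar p (int t * k)) = (if int p dvd k then of_nat p else 0)"
proof -
  have "addchar p k ^ p = 1"
    using assms by (simp add: addchar_power addchar_eq_1_iff)
  thus ?thesis
    using assms by (simp flip: addchar_power add: sum_gp_strict addchar_eq_1_iff)
qed

text \<open>Orthogonality packaged as a counting device. It is applied to pairs
  \<open>(x, y)\<close> with \<open>f\<close> equal to \<open>x ^ m - y ^ m\<close> for the mean
  square of the exponential sums, and to pairs \<open>(x, k)\<close> with \<open>x ^ m - k\<close>
  for the residue count.\<close>

lemma sum_addchar_count:
  assumes "p > 0" "finite A"
  shows "(\<Sum>t<p. \<Sum>a\<in>A. addchar p (int t * f a)) = of_nat p * of_nat (card {a \<in> A. int p dvd f a})"
proof -
  have "(\<Sum>t<p. \<Sum>a\<in>A. addchar p (int t * f a)) = (\<Sum>a\<in>A. if int p dvd f a then of_nat p else 0)"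
    by (subst sum.swap) (simp add: sum_addchar assms)
  also have "\<dots> = of_nat p * of_nat (card {a \<in> A. int p dvd f a})"
    using assms by (simp add: sum.If_cases Int_def)
  finally show ?thesis .
qed

lemma norm_one_minus_addchar: "norm (1 - addchar p t) = 2 * \<bar>sin (pi * of_int t / of_nat p)\<bar>"
proof -
  define y where "y = pi * real_of_int t / real p"
  have "(norm (1 - addchar p t))\<^sup>2 = (1 - cos (2 * y))\<^sup>2 + (sin (2 * y))\<^sup>2"
    by (simp add: addchar_def y_def cmod_power2 mult_ac)
  also have "\<dots> = 2 - 2 * cos (2 * y)"
    using sin_cos_squared_add[of "2 * y"] by (simp add: power2_eq_square algebra_simps)
  also have "\<dots> = (2 * \<bar>sin y\<bar>)\<^sup>2"
    by (simp add: cos_double_sin power_mult_distrib)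
  finally show ?thesis
    by (subst (asm) power2_eq_iff_nonneg) (auto simp: y_def)
qed

text \<open>In the closed form of the geometric sum with ratio \<open>z = addchar p t\<close>, the
  numerator has norm at most 2 whatever the length of the interval, so only the denominator
  \<open>1 - z\<close> enters the bound.\<close>

lemma norm_sum_addchar_interval_le:
  fixes t u v :: int
  assumes "p > 0" "\<not> int p dvd t"
  shows "norm (\<Sum>k\<in>{u..v}. addchar p (t * k)) \<le> 1 / \<bar>sin (pi * of_int t / of_nat p)\<bar>"
proof (cases "u \<le> v")
  case False
  thus ?thesis by simp
next
  case True
  define n where "n = nat (v - u + 1)"
  define z where "z = addchar p t"
  have z: "z \<noteq> 1" using assms by (simp add: z_def addchar_eq_1_iff)
  have "(\<Sum>k\<in>{u..v}. addchar p (t * k)) = (\<Sum>i<n. addchar p (t * (u + int i)))"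
    by (rule sum.reindex_bij_witness[of _ "\<lambda>i. u + int i" "\<lambda>k. nat (k - u)"])
       (use True in \<open>auto simp: n_def\<close>)
  also have "\<dots> = addchar p (t * u) * (\<Sum>i<n. z ^ i)"
    by (simp add: z_def addchar_power addchar_add ring_distribs sum_distrib_left mult_ac)
  also have "norm \<dots> = norm (1 - z ^ n) / norm (1 - z)"
    using z by (simp add: sum_gp_strict norm_mult norm_divide)
  also have "\<dots> \<le> 2 / norm (1 - z)"
  proof (rule divide_right_mono)
    show "norm (1 - z ^ n) \<le> 2"
      using norm_triangle_ineq4[of 1 "z ^ n"] by (simp add: z_def addchar_power)
  qed simp
  also have "\<dots> = 1 / \<bar>sin (pi * of_int t / of_nat p)\<bar>"
    by (simp add: z_def norm_one_minus_addchar)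
  finally show ?thesis .
qed

section \<open>Sine estimates and the sum of reciprocal sines\<close>

lemma sin_ge_cubic: "0 \<le> x \<Longrightarrow> x - x ^ 3 / 6 \<le> sin x" for x :: real
  using Maclaurin_sin_bound[of x 3]
  by (simp add: sin_coeff_def eval_nat_numeral abs_if split: if_splits)

text \<open>The cubic bound at \<open>pi / 6\<close>, where sine is 1/2, sharpens the crude
  \<open>pi < 4\<close>: from \<open>y \<le> 2 / 3\<close> it follows that
  \<open>y * (1 - 4 / 54) \<le> 1 / 2\<close>, that is, \<open>y \<le> 0.54\<close>.\<close>

lemma pi_le_3_24: "pi \<le> 3.24"
proof -
  define y where "y = pi / 6"
  have y: "0 < y" "y \<le> 2 / 3" using pi_less_4 by (auto simp: y_def)
  have "y\<^sup>2 \<le> (2 / 3)\<^sup>2" using y by (intro power_mono) auto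
  hence "y * y\<^sup>2 \<le> y * (2 / 3)\<^sup>2" using y by (intro mult_left_mono) auto
  moreover have "y - y ^ 3 / 6 \<le> 1 / 2"
    using sin_ge_cubic[of y] y by (simp add: y_def sin_30)
  ultimately have "y \<le> 0.54" by (simp add: power2_eq_square power3_eq_cube)
  thus ?thesis by (simp add: y_def)
qed

text \<open>Both sides are symmetric about \<open>pi / 2\<close>, so the left half suffices. There
  the cubic bound reduces the claim to \<open>pi * x \<le> 6\<close>, which follows from the
  estimate of \<open>pi\<close>.\<close>

lemma sin_ge_parabola:
  assumes "0 \<le> x" "x \<le> pi"
  shows "x * (pi - x) \<le> pi * sin x"
proof -
  have half: "x * (pi - x) \<le> pi * sin x" if "0 \<le> x" "x \<le> pi / 2" for x
  proof -
    have "pi * (x - x ^ 3 / 6) \<le> pi * sin x"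
      using sin_ge_cubic[of x] that by simp
    moreover have "pi * x \<le> 6"
    proof -
      have "pi * x \<le> 3.24 * (3.24 / 2)"
        using that pi_le_3_24 by (intro mult_mono) auto
      thus ?thesis by simp
    qed
    hence "(pi * x) * x\<^sup>2 \<le> 6 * x\<^sup>2" by (intro mult_right_mono) auto
    ultimately show ?thesis by (simp add: power2_eq_square power3_eq_cube algebra_simps)
  qed
  show ?thesis
  proof (cases "x \<le> pi / 2")
    case False
    thus ?thesis using half[of "pi - x"] assms by (simp add: mult.commute)
  qed (use half assms in auto)
qed

text \<open>The right-hand side is the partial fraction form of \<open>pi / (x * (pi - x))\<close>;
  this splitting turns the sum over \<open>t\<close> into two harmonic sums.\<close>

lemma inverse_sin_le:
  assumes "0 < x" "x < pi"
  shows "1 / sin x \<le> 1 / x + 1 / (pi - x)"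
proof -
  have "1 / x + 1 / (pi - x) = pi / (x * (pi - x))"
    using assms by (simp add: field_simps)
  moreover have "sin x > 0" using assms by (simp add: sin_gt_zero)
  ultimately show ?thesis
    using sin_ge_parabola[of x] assms by (simp add: field_simps)
qed

lemma harmonic_sum_le: "n > 0 \<Longrightarrow> (\<Sum>k=1..n. 1 / real k) \<le> 1 + ln (real n)"
proof (induction n rule: nat_induct_non_zero)
  case (Suc n)
  have "ln (1 + (- 1 / real (Suc n))) \<le> - 1 / real (Suc n)"
    using Suc by (intro ln_add_one_self_le_self2) (auto simp: field_simps)
  also have "1 + (- 1 / real (Suc n)) = real n / real (Suc n)"
    by (simp add: field_simps)
  finally have "1 / real (Suc n) \<le> ln (real (Suc n)) - ln (real n)"
    using Suc by (simp add: ln_div)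
  with Suc show ?case by simp
qed simp

lemma sum_inverse_sin_le:
  assumes "p > 1"
  shows "(\<Sum>t=1..<p. 1 / \<bar>sin (pi * real t / real p)\<bar>) \<le> 2 * real p / pi * (1 + ln (real p))"
proof -
  have "(\<Sum>t=1..<p. 1 / \<bar>sin (pi * real t / real p)\<bar>)
      \<le> (\<Sum>t=1..<p. real p / pi * (1 / real t) + real p / pi * (1 / real (p - t)))"
  proof (rule sum_mono)
    fix t assume t: "t \<in> {1..<p}"
    define x where "x = pi * real t / real p"
    have x: "0 < x" "x < pi" using t by (auto simp: x_def field_simps)
    have "pi - x = pi * real (p - t) / real p"
      using t by (simp add: x_def field_simps of_nat_diff)
    hence "1 / x + 1 / (pi - x) = real p / pi * (1 / real t) + real p / pi * (1 / real (p - t))"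
      by (simp add: x_def)
    with inverse_sin_le[OF x] sin_gt_zero[OF x]
    show "1 / \<bar>sin (pi * real t / real p)\<bar>
        \<le> real p / pi * (1 / real t) + real p / pi * (1 / real (p - t))"
      by (simp add: x_def)
  qed
  also have "\<dots> = real p / pi * (\<Sum>t=1..<p. 1 / real t) + real p / pi * (\<Sum>t=1..<p. 1 / real (p - t))"
    by (simp only: sum.distrib sum_distrib_left)
  \<comment> \<open>Reflecting \<open>t\<close> to \<open>p - t\<close> makes the two harmonic sums
    equal, hence the factor 2.\<close>
  also have "(\<Sum>t=1..<p. 1 / real (p - t)) = (\<Sum>t=1..<p. 1 / real t)"
    by (rule sum.reindex_bij_witness[of _ "\<lambda>t. p - t" "\<lambda>t. p - t"]) auto
  also have "real p / pi * (\<Sum>t=1..<p. 1 / real t) + real p / pi * (\<Sum>t=1..<p. 1 / real t)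
      = 2 * real p / pi * (\<Sum>t=1..<p. 1 / real t)"
    by simp
  also have "\<dots> \<le> 2 * real p / pi * (1 + ln (real p))"
  proof (rule mult_left_mono)
    have "(\<Sum>t=1..<p. 1 / real t) \<le> (\<Sum>t=1..p. 1 / real t)"
      by (rule sum_mono2) auto
    with harmonic_sum_le[of p] assms show "(\<Sum>t=1..<p. 1 / real t) \<le> 1 + ln (real p)" by simp
  qed simp
  finally show ?thesis .
qed

section \<open>Counting \<open>m\<close>th roots modulo a prime\<close>

text \<open>There are \<open>totient m > 0\<close> elements of order \<open>m\<close>; the first
  \<open>m\<close> powers of one such element \<open>a\<close> are distinct and exhaust the roots.
  The case \<open>m = 1\<close> is separate because this argument takes
  \<open>a \<noteq> 1\<close>.\<close>

lemma card_roots_of_unity_mod_prime: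
  fixes p m :: nat
  assumes "prime p" "m dvd p - 1" "m > 0"
  shows "card {z\<in>{..<p}. [z ^ m = 1] (mod p)} = m"
proof (cases "m = 1")
  case True
  have "{z\<in>{..<p}. [z ^ m = 1] (mod p)} = {1}"
    using prime_gt_1_nat[OF assms(1)] True by (auto simp: cong_def)
  thus ?thesis using True by simp
next
  case False
  have p: "p > 1" using assms(1) by (rule prime_gt_1_nat)
  have nz: "card {x\<in>totatives p. ord p x = m} \<noteq> 0"
    using prime_card_elements_with_ord_eq_totient[OF p assms(1), of m] assms by simp
  then obtain a where a: "a \<in> totatives p" "ord p a = m"
    by (metis (mono_tags, lifting) card.empty empty_Collect_eq)
  have "a \<noteq> 1" using a False by auto
  from prime_elements_with_ord(1,2)[OF p nz assms(1) a this] show ?thesis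
    by (simp add: card_image)
qed

text \<open>Multiplication by \<open>x\<close> carries the \<open>m\<close>th roots of unity
  bijectively onto the solutions; multiplication by an inverse \<open>w\<close> of \<open>x\<close>
  goes back.\<close>

lemma card_mth_roots_mod_prime:
  fixes p m :: nat and x :: int
  assumes "prime p" "m dvd p - 1" "m > 0" "\<not> int p dvd x"
  shows "card {y\<in>{..<p}. [int y ^ m = x ^ m] (mod int p)} = m"
proof -
  have p: "p > 0" using assms(1) by (rule prime_gt_0_nat)
  have "coprime x (int p)"
    using assms prime_imp_coprime[of "int p" x] by (simp add: coprime_commute)
  then obtain w where w: "[x * w = 1] (mod int p)"
    using coprime_iff_invertible_int by blast
  have wm: "[x ^ m * w ^ m = 1] (mod int p)"
    using cong_pow[OF w, of m] by (simp add: power_mult_distrib)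
  have "bij_betw (\<lambda>z. nat ((x * int z) mod int p)) {z\<in>{..<p}. [z ^ m = 1] (mod p)}
          {y\<in>{..<p}. [int y ^ m = x ^ m] (mod int p)}"
  proof (rule bij_betw_byWitness[where f' = "\<lambda>y. nat ((w * int y) mod int p)"])
    \<comment> \<open>Stated for a general inverse pair so that it serves both compositions, with
      \<open>x\<close> and \<open>w\<close> exchanged.\<close>
    have inv: "nat ((b * int (nat ((a * int z) mod int p))) mod int p) = z"
      if "[a * b = 1] (mod int p)" "z < p" for a b :: int and z
    proof -
      have "(b * int (nat ((a * int z) mod int p))) mod int p = (a * b) mod int p * int z mod int p"
        using p by (simp add: mod_simps mult_ac)
      also have "\<dots> = 1 mod int p * int z mod int p"
        using that by (simp add: cong_def)
      finally show ?thesis using that by (simp add: mod_simps)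
    qed
    show "\<forall>z\<in>{z\<in>{..<p}. [z ^ m = 1] (mod p)}.
        nat ((w * int (nat ((x * int z) mod int p))) mod int p) = z"
      using inv[OF w] by auto
    show "\<forall>z\<in>{y\<in>{..<p}. [int y ^ m = x ^ m] (mod int p)}.
        nat ((x * int (nat ((w * int z) mod int p))) mod int p) = z"
      using inv[of w x] w by (auto simp: mult.commute)
    have less: "nat (c mod int p) < p" for c
      using p by (simp add: nat_less_iff)
    have pow: "[int (nat ((a * int z) mod int p)) ^ m = a ^ m * int z ^ m] (mod int p)" for a z
      using p by (simp add: cong_def mod_simps flip: power_mult_distrib)
    show "(\<lambda>z. nat ((x * int z) mod int p)) ` {z\<in>{..<p}. [z ^ m = 1] (mod p)}
        \<subseteq> {y\<in>{..<p}. [int y ^ m = x ^ m] (mod int p)}"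
    proof safe
      fix z assume "[z ^ m = 1] (mod p)"
      hence "[int z ^ m = 1] (mod int p)"
        by (simp flip: cong_int_iff)
      hence "[x ^ m * int z ^ m = x ^ m * 1] (mod int p)" by (rule cong_scalar_left)
      with pow[of x z] show "[int (nat ((x * int z) mod int p)) ^ m = x ^ m] (mod int p)"
        by (auto intro: cong_trans)
    qed (use less in auto)
    show "(\<lambda>y. nat ((w * int y) mod int p)) ` {y\<in>{..<p}. [int y ^ m = x ^ m] (mod int p)}
        \<subseteq> {z\<in>{..<p}. [z ^ m = 1] (mod p)}"
    proof safe
      fix y assume "[int y ^ m = x ^ m] (mod int p)"
      hence "[w ^ m * int y ^ m = w ^ m * x ^ m] (mod int p)" by (rule cong_scalar_left)
      with pow[of w y] wm have "[int (nat ((w * int y) mod int p)) ^ m = 1] (mod int p)"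
        by (metis cong_trans mult.commute)
      thus "[nat ((w * int y) mod int p) ^ m = 1] (mod p)"
        by (simp flip: cong_int_iff)
    qed (use less in auto)
  qed
  from bij_betw_same_card[OF this] show ?thesis
    using card_roots_of_unity_mod_prime[OF assms(1-3)] by simp
qed

section \<open>Mean square and pointwise bound of the exponential sums\<close>

text \<open>The sum \<open>G_t\<close> of the overview, a Gauss sum of order \<open>m\<close>. The
  term \<open>x = 0\<close> is included, so the value at \<open>t = 0\<close> is
  \<open>p\<close>.\<close>

definition power_sum :: "nat \<Rightarrow> nat \<Rightarrow> int \<Rightarrow> complex" where
  "power_sum p m t = (\<Sum>x<p. addchar p (t * int x ^ m))"

text \<open>Parseval: the squared norm expands to a double sum over \<open>x\<close> and
  \<open>y\<close>, and summing over \<open>t\<close> keeps exactly the pairs with congruent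
  \<open>m\<close>th powers.\<close>

lemma sum_norm_power_sum_sq:
  assumes "p > 0"
  shows "(\<Sum>t<p. (norm (power_sum p m (int t)))\<^sup>2)
       = real p * real (\<Sum>x<p. card {y\<in>{..<p}. [int y ^ m = int x ^ m] (mod int p)})"
proof -
  let ?f = "\<lambda>(x, y). int x ^ m - int y ^ m"
  have "of_real ((norm (power_sum p m (int t)))\<^sup>2)
      = (\<Sum>a\<in>{..<p} \<times> {..<p}. addchar p (int t * ?f a))" for t
    unfolding complex_norm_square power_sum_def
    by (simp add: sum_product sum.cartesian_product addchar_diff right_diff_distrib split_def)
  hence "of_real (\<Sum>t<p. (norm (power_sum p m (int t)))\<^sup>2)
      = (\<Sum>t<p. \<Sum>a\<in>{..<p} \<times> {..<p}. addchar p (int t * ?f a))"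
    by (simp del: of_real_power)
  also have "\<dots> = of_nat p * of_nat (card {a\<in>{..<p} \<times> {..<p}. int p dvd ?f a})"
    by (rule sum_addchar_count) (use assms in auto)
  also have "{a\<in>{..<p} \<times> {..<p}. int p dvd ?f a}
      = (SIGMA x:{..<p}. {y\<in>{..<p}. [int y ^ m = int x ^ m] (mod int p)})"
    by (auto simp: cong_iff_dvd_diff dvd_diff_commute)
  also have "card \<dots> = (\<Sum>x<p. card {y\<in>{..<p}. [int y ^ m = int x ^ m] (mod int p)})"
    by (rule card_SigmaI) auto
  finally have "complex_of_real (\<Sum>t<p. (norm (power_sum p m (int t)))\<^sup>2)
      = complex_of_real (real p * real (\<Sum>x<p. card {y\<in>{..<p}. [int y ^ m = int x ^ m] (mod int p)}))"
    by simp
  thus ?thesis by (simp only: of_real_eq_iff)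
qed

lemma card_zero_roots_mod_prime:
  assumes "prime p" "m > 0" "int p dvd k"
  shows "card {y\<in>{..<p}. [int y ^ m = k] (mod int p)} = 1"
proof -
  have "[int y ^ m = k] (mod int p) \<longleftrightarrow> y = 0" if "y < p" for y
  proof -
    have "[int y ^ m = k] (mod int p) \<longleftrightarrow> int p dvd int y ^ m"
      using assms(3) by (simp add: cong_iff_dvd_diff dvd_diff_left_iff)
    also have "\<dots> \<longleftrightarrow> p dvd y"
      using assms prime_dvd_power_iff[of "int p" m "int y"] by simp
    also have "\<dots> \<longleftrightarrow> y = 0"
      using that by (auto dest: dvd_imp_le)
    finally show ?thesis .
  qed
  hence "{y\<in>{..<p}. [int y ^ m = k] (mod int p)} = {0}"
    using prime_gt_0_nat[OF assms(1)] by auto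
  thus ?thesis by simp
qed

text \<open>The pairs number \<open>1 + (p - 1) * m\<close>: one with \<open>x = 0\<close>, and
  \<open>m\<close> for each other \<open>x\<close>. Removing the term \<open>t = 0\<close>, which is
  the square of \<open>p\<close>, leaves the stated product.\<close>

lemma sum_norm_power_sum_sq_nonzero:
  assumes "prime p" "m dvd p - 1" "m > 0"
  shows "(\<Sum>t=1..<p. (norm (power_sum p m (int t)))\<^sup>2) = real p * (real p - 1) * (real m - 1)"
proof -
  have p: "p > 0" using assms(1) by (rule prime_gt_0_nat)
  have split: "{..<p} = insert 0 {1..<p}" using p by auto
  have "(\<Sum>x<p. card {y\<in>{..<p}. [int y ^ m = int x ^ m] (mod int p)})
      = 1 + (\<Sum>x=1..<p. card {y\<in>{..<p}. [int y ^ m = int x ^ m] (mod int p)})"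
    by (subst split, subst sum.insert) (use assms card_zero_roots_mod_prime[of p m 0] in \<open>auto simp: zero_power\<close>)
  also have "(\<Sum>x=1..<p. card {y\<in>{..<p}. [int y ^ m = int x ^ m] (mod int p)}) = (\<Sum>x=1..<p. m)"
    by (intro sum.cong refl card_mth_roots_mod_prime assms) (auto dest: dvd_imp_le)
  finally have cnt: "(\<Sum>x<p. card {y\<in>{..<p}. [int y ^ m = int x ^ m] (mod int p)}) = 1 + (p - 1) * m"
    by simp
  have "(\<Sum>t<p. (norm (power_sum p m (int t)))\<^sup>2)
      = (real p)\<^sup>2 + (\<Sum>t=1..<p. (norm (power_sum p m (int t)))\<^sup>2)"
    by (subst split, subst sum.insert) (auto simp: power_sum_def)
  with sum_norm_power_sum_sq[OF p, of m] show ?thesis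
    using p unfolding cnt by (simp add: of_nat_diff algebra_simps power2_eq_square)
qed

text \<open>The factor \<open>s ^ m\<close> is absorbed by the substitution of \<open>s * x\<close>
  for \<open>x\<close>, which permutes the residues modulo \<open>p\<close>.\<close>

lemma power_sum_mult_power:
  assumes "prime p" "\<not> int p dvd s"
  shows "power_sum p m (t * s ^ m) = power_sum p m t"
proof -
  have p: "p > 0" using assms(1) by (rule prime_gt_0_nat)
  have cop: "coprime s (int p)"
    using assms prime_imp_coprime[of "int p" s] by (simp add: coprime_commute)
  let ?h = "\<lambda>x. nat ((s * int x) mod int p)"
  have inj: "inj_on ?h {..<p}"
  proof (rule inj_onI)
    fix x y assume xy: "x \<in> {..<p}" "y \<in> {..<p}" "?h x = ?h y"
    hence "[s * int x = s * int y] (mod int p)"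
      using p by (simp add: cong_def eq_nat_nat_iff)
    hence "[int x = int y] (mod int p)"
      using cop cong_mult_lcancel by blast
    thus "x = y" using xy by (simp add: cong_def)
  qed
  have "?h ` {..<p} \<subseteq> {..<p}" using p by (auto simp: nat_less_iff)
  with inj have im: "?h ` {..<p} = {..<p}" by (intro endo_inj_surj) auto
  have "power_sum p m t = (\<Sum>x\<in>?h ` {..<p}. addchar p (t * int x ^ m))"
    unfolding power_sum_def by (simp only: im)
  also have "\<dots> = (\<Sum>x<p. addchar p (t * int (?h x) ^ m))"
    using inj by (simp add: sum.reindex)
  also have "\<dots> = (\<Sum>x<p. addchar p (t * s ^ m * int x ^ m))"
  proof (intro sum.cong refl addchar_cong[OF p])
    fix x
    have "[int (?h x) ^ m = (s * int x) ^ m] (mod int p)"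
      using p by (simp add: cong_def mod_simps)
    hence "[t * int (?h x) ^ m = t * (s * int x) ^ m] (mod int p)"
      by (rule cong_scalar_left)
    thus "[t * int (?h x) ^ m = t * s ^ m * int x ^ m] (mod int p)"
      by (simp add: power_mult_distrib mult.assoc)
  qed
  finally show ?thesis by (simp add: power_sum_def)
qed

lemma power_sum_cong:
  assumes "p > 0" "[s = t] (mod int p)"
  shows "power_sum p m s = power_sum p m t"
  unfolding power_sum_def using assms
  by (intro sum.cong refl addchar_cong cong_scalar_right) auto

text \<open>Averaging: as \<open>s\<close> runs over the nonzero residues, \<open>t * s ^ m\<close>
  hits each residue at most \<open>m\<close> times while the norm stays constant. Hence
  \<open>p - 1\<close> copies of the squared norm are at most \<open>m\<close> times the total mean
  square.\<close>

lemma norm_power_sum_le: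
  fixes t :: nat
  assumes "prime p" "m dvd p - 1" "m > 0" "\<not> p dvd t"
  shows "norm (power_sum p m (int t)) \<le> sqrt (real m * (real m - 1) * real p)"
proof -
  have p: "p > 1" using assms(1) by (rule prime_gt_1_nat)
  let ?F = "\<lambda>u. (norm (power_sum p m (int u)))\<^sup>2"
  let ?h = "\<lambda>s. (t * s ^ m) mod p"
  have ndvd: "\<not> p dvd s" if "s \<in> {1..<p}" for s
    using that by (auto dest: dvd_imp_le)
  have F: "?F (?h s) = ?F t" if "s \<in> {1..<p}" for s
  proof -
    have "power_sum p m (int (?h s)) = power_sum p m (int t * int s ^ m)"
      by (rule power_sum_cong) (use p in \<open>auto simp: cong_def zmod_int\<close>)
    also have "\<dots> = power_sum p m (int t)"
      by (rule power_sum_mult_power) (use assms ndvd[OF that] in auto)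
    finally show ?thesis by simp
  qed
  have h: "?h ` {1..<p} \<subseteq> {1..<p}"
  proof safe
    fix s assume s: "s \<in> {1..<p}"
    have "\<not> p dvd t * s ^ m"
      using assms ndvd[OF s] by (auto simp: prime_dvd_mult_iff dest: prime_dvd_power)
    thus "?h s \<in> {1..<p}"
      using p by (auto simp: dvd_eq_mod_eq_0 Suc_le_eq)
  qed
  have fibre: "card {s\<in>{1..<p}. ?h s = u} \<le> m" for u
  proof (cases "{s\<in>{1..<p}. ?h s = u} = {}")
    case False
    then obtain r where r: "r \<in> {1..<p}" "?h r = u" by blast
    have cop: "coprime t p"
      using assms prime_imp_coprime[of p t] by (simp add: coprime_commute)
    \<comment> \<open>Cancelling \<open>t\<close> places a nonempty fibre among the roots of a
      polynomial congruence of degree \<open>m\<close>.\<close>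
    have "{s\<in>{1..<p}. ?h s = u} \<subseteq> {s\<in>{..<p}. [s ^ m = r ^ m] (mod p)}"
    proof safe
      fix s assume "u = ?h s"
      hence "[t * s ^ m = t * r ^ m] (mod p)" using r by (simp add: cong_def)
      thus "[s ^ m = r ^ m] (mod p)" using cop cong_mult_lcancel_nat by blast
    qed auto
    hence "card {s\<in>{1..<p}. ?h s = u} \<le> card {s\<in>{..<p}. [s ^ m = r ^ m] (mod p)}"
      by (intro card_mono) auto
    also have "\<dots> \<le> m" using assms by (intro roots_mod_prime_bound) auto
    finally show ?thesis .
  next
    case True
    thus ?thesis by (simp only: card.empty zero_le)
  qed
  have "(real p - 1) * ?F t = (\<Sum>s=1..<p. ?F (?h s))"
    using F p by (simp add: of_nat_diff)
  \<comment> \<open>Regroup by the value \<open>u\<close>, so that the fibre bound leaves a sum over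
    all nonzero frequencies.\<close>
  also have "\<dots> = (\<Sum>u=1..<p. real (card {s\<in>{1..<p}. ?h s = u}) * ?F u)"
    by (rule sum_fun_comp) (use h in auto)
  also have "\<dots> \<le> (\<Sum>u=1..<p. real m * ?F u)"
    by (intro sum_mono mult_right_mono) (use fibre in auto)
  also have "\<dots> = (real p - 1) * (real m * (real m - 1) * real p)"
    unfolding sum_distrib_left[symmetric] sum_norm_power_sum_sq_nonzero[OF assms(1-3)] by simp
  finally have "?F t \<le> real m * (real m - 1) * real p"
    using p by simp
  thus ?thesis by (rule real_le_rsqrt)
qed

section \<open>Counting power residues in an integer interval\<close>

text \<open>The indicator of power residues, scaled by \<open>m\<close>, becomes a solution count
  that additive characters can detect.\<close>

lemma card_roots_eq_power_residue:
  assumes "prime p" "m dvd p - 1" "m > 0" "\<not> int p dvd k"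
  shows "card {x\<in>{..<p}. [int x ^ m = k] (mod int p)} = (if power_residue m p k then m else 0)"
proof (cases "power_residue m p k")
  case True
  then obtain x where x: "[k = x ^ m] (mod int p)" by (auto simp: power_residue_def)
  have "\<not> int p dvd x"
    using assms(3,4) x by (meson cong_dvd_iff dvd_power dvd_trans)
  moreover have "[int y ^ m = k] (mod int p) \<longleftrightarrow> [int y ^ m = x ^ m] (mod int p)" for y
    using x by (meson cong_sym cong_trans)
  ultimately show ?thesis
    using card_mth_roots_mod_prime[OF assms(1-3), of x] True by simp
next
  case False
  hence none: "{x\<in>{..<p}. [int x ^ m = k] (mod int p)} = {}"
    using assms(4) by (auto simp: power_residue_def dest: cong_sym)
  show ?thesis unfolding none using False by simp
qed

text \<open>The bounds on \<open>u\<close> and \<open>v\<close> keep multiples of \<open>p\<close>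
  out of the interval, so each residue \<open>k\<close> contributes exactly \<open>m\<close> roots
  and each nonresidue none.\<close>

lemma power_residue_count_interval:
  fixes u v :: int
  assumes "prime p" "m dvd p - 1" "m > 0" "0 < u" "v < int p"
  shows "\<bar>real m * real (card {k\<in>{u..v}. power_residue m p k}) - real (card {u..v})\<bar>
       \<le> sqrt (real m * (real m - 1) * real p) * (2 / pi * (1 + ln (real p)))"
proof -
  have p: "p > 1" using assms(1) by (rule prime_gt_1_nat)
  define N where "N = card {k\<in>{u..v}. power_residue m p k}"
  define B where "B = sqrt (real m * (real m - 1) * real p)"
  define E where "E = (\<lambda>t::nat. \<Sum>k\<in>{u..v}. addchar p (int t * k))"
  let ?f = "\<lambda>(x, k). int x ^ m - k"
  \<comment> \<open>Swapping the coordinates allows counting the pairs fibrewise over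
    \<open>k\<close>.\<close>
  have "{a\<in>{..<p} \<times> {u..v}. int p dvd ?f a}
      = (\<lambda>(k, x). (x, k)) ` (SIGMA k:{u..v}. {x\<in>{..<p}. [int x ^ m = k] (mod int p)})"
    by (auto simp: cong_iff_dvd_diff)
  hence "card {a\<in>{..<p} \<times> {u..v}. int p dvd ?f a}
      = card (SIGMA k:{u..v}. {x\<in>{..<p}. [int x ^ m = k] (mod int p)})"
    by (simp add: card_image inj_on_def split_def prod_eq_iff)
  also have "\<dots> = (\<Sum>k\<in>{u..v}. card {x\<in>{..<p}. [int x ^ m = k] (mod int p)})"
    by (rule card_SigmaI) auto
  also have "\<dots> = (\<Sum>k\<in>{u..v}. if power_residue m p k then m else 0)"
    by (intro sum.cong refl card_roots_eq_power_residue) (use assms in \<open>auto dest: zdvd_imp_le\<close>)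
  also have "\<dots> = N * m"
    by (simp add: sum.If_cases N_def Int_def)
  finally have cnt: "card {a\<in>{..<p} \<times> {u..v}. int p dvd ?f a} = N * m" .

  have "of_nat p * of_nat (N * m) = (\<Sum>t<p. \<Sum>a\<in>{..<p} \<times> {u..v}. addchar p (int t * ?f a))"
    unfolding cnt[symmetric] by (rule sum_addchar_count[symmetric]) (use p in auto)
  also have "\<dots> = (\<Sum>t<p. power_sum p m (int t) * cnj (E t))"
    by (simp add: power_sum_def E_def sum_product sum.cartesian_product addchar_diff
        right_diff_distrib split_def)
  also have "{..<p} = insert 0 {1..<p}" using p by auto
  \<comment> \<open>The frequency \<open>t = 0\<close> yields the main term; all others go into the
    error.\<close>
  also have "(\<Sum>t\<in>insert 0 {1..<p}. power_sum p m (int t) * cnj (E t))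
      = of_nat p * of_nat (card {u..v}) + (\<Sum>t=1..<p. power_sum p m (int t) * cnj (E t))"
    by (subst sum.insert) (auto simp: power_sum_def E_def)
  finally have eq: "complex_of_real (real p * (real m * real N - real (card {u..v})))
      = (\<Sum>t=1..<p. power_sum p m (int t) * cnj (E t))"
    by (simp add: algebra_simps)
  have "real p * \<bar>real m * real N - real (card {u..v})\<bar>
      = norm (complex_of_real (real p * (real m * real N - real (card {u..v}))))"
    unfolding norm_of_real by (simp add: abs_mult)
  also have "\<dots> \<le> (\<Sum>t=1..<p. norm (power_sum p m (int t) * cnj (E t)))"
    unfolding eq by (rule norm_sum)
  also have "\<dots> \<le> (\<Sum>t=1..<p. B * (1 / \<bar>sin (pi * real t / real p)\<bar>))"
  proof (rule sum_mono)
    fix t assume "t \<in> {1..<p}"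
    hence t: "\<not> p dvd t" by (auto dest: dvd_imp_le)
    have "norm (E t) \<le> 1 / \<bar>sin (pi * real t / real p)\<bar>"
      using norm_sum_addchar_interval_le[of p "int t" u v] p t by (simp add: E_def)
    moreover have "norm (power_sum p m (int t)) \<le> B"
      unfolding B_def by (rule norm_power_sum_le) (use assms t in auto)
    ultimately show "norm (power_sum p m (int t) * cnj (E t)) \<le> B * (1 / \<bar>sin (pi * real t / real p)\<bar>)"
      unfolding norm_mult complex_mod_cnj using assms by (intro mult_mono) (auto simp: B_def)
  qed
  also have "\<dots> \<le> B * (2 * real p / pi * (1 + ln (real p)))"
    unfolding sum_distrib_left[symmetric] using sum_inverse_sin_le[OF p] assms
    by (intro mult_left_mono) (auto simp: B_def)
  also have "\<dots> = real p * (B * (2 / pi * (1 + ln (real p))))"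
    by simp
  finally have "\<bar>real m * real N - real (card {u..v})\<bar> \<le> B * (2 / pi * (1 + ln (real p)))"
    by (rule mult_left_le_imp_le) (use p in auto)
  thus ?thesis by (simp only: N_def B_def)
qed

section \<open>The constant and real endpoints\<close>

text \<open>After squaring, the claim is \<open>(m - 1) * (5 * m - 9) \<ge> 0\<close>, true from
  \<open>m = 2\<close> on. It trades the square root coming from the averaging for the factor
  \<open>3 * (1 - 1 / m)\<close> after division by \<open>m\<close>.\<close>

lemma two_sqrt_le_three:
  assumes "m > 1"
  shows "2 * sqrt (real m * (real m - 1)) \<le> 3 * (real m - 1)"
proof -
  have "2 * sqrt (real m * (real m - 1)) = sqrt (4 * (real m * (real m - 1)))"
    by (simp add: real_sqrt_mult)
  also have "\<dots> \<le> sqrt ((3 * (real m - 1))\<^sup>2)"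
  proof (rule real_sqrt_le_mono)
    have "0 \<le> (real m - 1) * (5 * real m - 9)" using assms by (intro mult_nonneg_nonneg) auto
    thus "4 * (real m * (real m - 1)) \<le> (3 * (real m - 1))\<^sup>2"
      by (simp add: power2_eq_square algebra_simps)
  qed
  also have "\<dots> = 3 * (real m - 1)" using assms by simp
  finally show ?thesis .
qed

lemma power_residue_count_real_interval:
  fixes a b :: real
  assumes "prime p" "m dvd p - 1" "m > 1" "a < b" "{a<..<b} \<subseteq> {0<..<real p}"
  defines "q \<equiv> 3 / pi * (1 - 1 / real m)"
  shows "\<bar>real (card {k::int. real_of_int k \<in> {a<..<b} \<and> power_residue m p k}) - (b - a) / real m\<bar>
       \<le> q * sqrt (real p) * (1 + ln (real p)) + 1"
proof -
  have p: "p > 1" using assms(1) by (rule prime_gt_1_nat)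
  have ab: "0 \<le> a" "b \<le> real p"
    using assms(4,5) by (auto simp: greaterThanLessThan_subseteq_greaterThanLessThan)
  \<comment> \<open>The least integer above \<open>a\<close>, and then the greatest below
    \<open>b\<close>: the interval is open, so integral endpoints must be excluded.\<close>
  define u where "u = \<lfloor>a\<rfloor> + 1"
  define v where "v = \<lceil>b\<rceil> - 1"
  have mem: "real_of_int k \<in> {a<..<b} \<longleftrightarrow> k \<in> {u..v}" for k
    by (auto simp: u_def v_def) linarith+
  have uv: "0 < u" "v < int p" using ab by (auto simp: u_def v_def) linarith+
  have "real (card {u..v}) = of_int (\<lceil>b\<rceil> - \<lfloor>a\<rfloor> - 1)"
    using assms(4) by (simp add: u_def v_def) linarith
  hence len: "\<bar>real (card {u..v}) - (b - a)\<bar> \<le> 1" by linarith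
  define N where "N = real (card {k\<in>{u..v}. power_residue m p k})"
  have "\<bar>real m * N - real (card {u..v})\<bar>
      \<le> sqrt (real m * (real m - 1) * real p) * (2 / pi * (1 + ln (real p)))"
    unfolding N_def by (rule power_residue_count_interval) (use assms uv in auto)
  also have "\<dots> = (2 * sqrt (real m * (real m - 1))) * (sqrt (real p) * (1 + ln (real p)) / pi)"
    by (simp add: real_sqrt_mult)
  also have "\<dots> \<le> (3 * (real m - 1)) * (sqrt (real p) * (1 + ln (real p)) / pi)"
    using two_sqrt_le_three[OF assms(3)] p by (intro mult_right_mono) auto
  also have "\<dots> = real m * (q * sqrt (real p) * (1 + ln (real p)))"
    using assms(3) by (simp add: q_def field_simps)
  finally have "\<bar>real m * N - (b - a)\<bar> \<le> real m * (q * sqrt (real p) * (1 + ln (real p))) + 1"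
    using len by linarith
  \<comment> \<open>The rounding error 1 is enlarged to \<open>m\<close> so that a common factor
    \<open>m\<close> can be cancelled.\<close>
  also have "\<dots> \<le> real m * (q * sqrt (real p) * (1 + ln (real p)) + 1)"
    using assms(3) by (simp add: algebra_simps)
  also have "\<bar>real m * N - (b - a)\<bar> = real m * \<bar>N - (b - a) / real m\<bar>"
  proof -
    have "real m * N - (b - a) = real m * (N - (b - a) / real m)"
      using assms(3) by (simp add: field_simps)
    thus ?thesis by (simp add: abs_mult)
  qed
  finally have "\<bar>N - (b - a) / real m\<bar> \<le> q * sqrt (real p) * (1 + ln (real p)) + 1"
    using assms(3) by simp
  thus ?thesis by (simp only: N_def mem)
qed

theorem theorem2:
  fixes m :: nat and C :: real
  assumes "m > 1"
    and "C > 3 / pi * (1 - 1 / real m)"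
  shows "\<exists>p\<^sub>0::nat. \<forall>p::nat. prime p \<and> p > p\<^sub>0 \<and> [p = 1] (mod m) \<longrightarrow>
           (\<forall>a b :: real. a < b \<and> {a<..<b} \<subseteq> {0<..<real p} \<longrightarrow>
             \<bar>real (card {k::int. real_of_int k \<in> {a<..<b} \<and> power_residue m p k}) - (b - a) / real m\<bar>
               \<le> C * sqrt (real p) * ln (real p))"
proof -
  define q where "q = 3 / pi * (1 - 1 / real m)"
  \<comment> \<open>Once \<open>ln p \<ge> L\<close>, the slack \<open>(C - q) * ln p\<close>
    absorbs the lower-order terms \<open>q\<close> and 1.\<close>
  define L where "L = (q + 1) / (C - q)"
  have q: "q < C" using assms(2) by (simp add: q_def)
  show ?thesis
  proof (intro exI[of _ "nat \<lceil>exp L\<rceil>"] allI impI, elim conjE)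
    fix p :: nat and a b :: real
    assume pm: "prime p" "p > nat \<lceil>exp L\<rceil>" "[p = 1] (mod m)"
      and ab: "a < b" "{a<..<b} \<subseteq> {0<..<real p}"
    have p: "p > 1" using pm(1) by (rule prime_gt_1_nat)
    have dvd: "m dvd p - 1"
      using pm(3) p by (simp add: cong_altdef_nat)
    have "exp L \<le> real p" using pm(2) by linarith
    hence "L \<le> ln (real p)" using p by (simp add: ln_ge_iff)
    hence "q + 1 \<le> (C - q) * ln (real p)"
      using q by (simp add: L_def field_simps)
    hence ln: "q * (1 + ln (real p)) + 1 \<le> C * ln (real p)"
      by (simp add: algebra_simps)
    \<comment> \<open>The additive 1 is bounded by \<open>sqrt p\<close>, giving a common
      factor.\<close>
    have "q * sqrt (real p) * (1 + ln (real p)) + 1 \<le> sqrt (real p) * (q * (1 + ln (real p)) + 1)"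
      using p by (simp add: algebra_simps)
    also have "\<dots> \<le> sqrt (real p) * (C * ln (real p))"
      using ln by (intro mult_left_mono) auto
    finally show "\<bar>real (card {k::int. real_of_int k \<in> {a<..<b} \<and> power_residue m p k}) - (b - a) / real m\<bar>
        \<le> C * sqrt (real p) * ln (real p)"
      using power_residue_count_real_interval[OF pm(1) dvd assms(1) ab] by (simp add: q_def mult_ac)
  qed
qed

end
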